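(* Let $\Phi=(A;\{E_i\}_{i=0}^d;A^*;\{E^*_i\}_{i=0}^d)$ be a Leonard system in $\mathcal{A}$ with parameter array $(\{\theta_i\}_{i=0}^d;\{\theta^*_i\}_{i=0}^d;\{\varphi_i\}_{i=1}^d;\{\phi_i\}_{i=1}^d)$, and let $\xi_0\in E_0V$, $\xi_d\in E_dV$, $\xi^*_0\in E^*_0V$, $\xi^*_d\in E^*_dV$ be nonzero vectors. Then (i) and (ii) hold. (i) Let $\{X_i\}_{i=0}^d$ denote one of the sequences $\{E_i\}_{i=0}^d$, $\{E_{d-i}\}_{i=0}^d$, $\{\tau_i(A)\}_{i=0}^d$, $\{\tau_{d-i}(A)\}_{i=0}^d$, $\{\eta_i(A)\}_{i=0}^d$, $\{\eta_{d-i}(A)\}_{i=0}^d$. Then for $0\le i\le d$, \begin{align*} \frac{\eta^*_d(\theta^*_0)}{\varphi}\frac{\langle\xi_d,\xi^*_0\rangle}{\langle\xi_d,\xi^*_d\rangle}\sum_{r=0}^d \tau_r(\theta_r)\eta_{d-r}(\theta_r)X_rE^*_0E_r\cdot E_i\xi^*_d &= X_i\xi^*_0,\\ \sum_{r=0}^d \frac{X_rE^*_dE_r}{\mathrm{tr}(E_rE^*_d)}\cdot E_i\xi^*_d &= X_i\xi^*_d,\\ \frac{\eta^*_d(\theta^*_0)}{\varphi}\frac{\langle\xi_d,\xi^*_0\rangle}{\langle\xi_d,\xi^*_d\rangle}\sum_{r=0}^d \tau_r(\theta_r)\eta_{d-r}(\theta_r)X_{d-r}E^*_0E_r\cdot E_{d-i}\xi^*_d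 &= X_i\xi^*_0,\\ \sum_{r=0}^d \frac{X_{d-r}E^*_dE_r}{\mathrm{tr}(E_rE^*_d)}\cdot E_{d-i}\xi^*_d &= X_i\xi^*_d. \end{align*} (ii) Let $\{X_i\}_{i=0}^d$ denote one of the sequences $\{E^*_i\}_{i=0}^d$, $\{E^*_{d-i}\}_{i=0}^d$, $\{\tau^*_i(A^* )\}_{i=0}^d$, $\{\tau^*_{d-i}(A^* )\}_{i=0}^d$, $\{\eta^*_i(A^* )\}_{i=0}^d$, $\{\eta^*_{d-i}(A^* )\}_{i=0}^d$. Then for $0\le i\le d$, \begin{align*} \frac{\langle\xi_0,\xi_0\rangle}{\langle\xi_0,\xi^*_d\rangle}\sum_{r=0}^d\frac{X_rE_0E^*_dE_r}{\mathrm{tr}(E_rE^*_d)}\cdot E_i\xi^*_d &= X_i\xi_0,\\ \frac{\langle\xi_d,\xi_d\rangle}{\langle\xi_d,\xi^*_d\rangle}\sum_{r=0}^d\frac{X_rE_dE^*_dE_r}{\mathrm{tr}(E_rE^*_d)}\cdot E_i\xi^*_d &= X_i\xi_d,\\ \frac{\langle\xi_0,\xi_0\rangle}{\langle\xi_0,\xi^*_d\rangle}\sum_{r=0}^d\frac{X_{d-r}E_0E^*_dE_r}{\mathrm{tr}(E_rE^*_d)}\cdot E_{d-i}\xi^*_d &= X_i\xi_0,\\ \frac{\langle\xi_d,\xi_d\rangle}{\langle\xi_d,\xi^*_d\rangle}\sum_{r=0}^d\frac{X_{d-r}E_dE^*_dE_r}{\mathrm{tr}(E_rE^*_d)}\cdot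 E_{d-i}\xi^*_d &= X_i\xi_d. \end{align*}
   Context: Let $\mathbb{K}$ be a field, $d\ge 0$ an integer, $\mathcal{A}$ a $\mathbb{K}$-algebra isomorphic to the algebra $\mathrm{Mat}_{d+1}(\mathbb{K})$ of all $(d+1)\times(d+1)$ matrices over $\mathbb{K}$, $I$ its identity, and $V$ an irreducible left $\mathcal{A}$-module (so $\dim V=d+1$). For $X\in\mathcal{A}$, $\mathrm{tr}(X)$ is the trace of $X$ (equivalently of its action on $V$). Leonard system. An element of $\mathcal{A}$ is multiplicity-free if it has $d+1$ mutually distinct eigenvalues in $\mathbb{K}$. If $A$ is multiplicity-free with eigenvalues $\theta_0,\dots,\theta_d$, the primitive idempotent of $A$ associated with $\theta_i$ is $E_i=\prod_{0\le j\le d,\,j\ne i}\frac{A-\theta_jI}{\theta_i-\theta_j}$ (the projection onto the one-dimensional $\theta_i$-eigenspace $E_iV$). A Leonard system in $\mathcal{A}$ is a sequence $\Phi=(A;\{E_i\}_{i=0}^d;A^*;\{E^*_i\}_{i=0}^d)$ such that: (i) each of $A,A^*$ is a multiplicity-free element of $\mathcal{A}$ ($A^*$ is just another element; no adjoint is meant); (ii) $\{E_i\}_{i=0}^d$ is an ordering of the primitive idempotents of $A$; (iii) $\{E^*_i\}_{i=0}^d$ is an ordering of the primitive idempotents of $A^*$; (iv) for $0\le i,j\le d$, $E_iA^*E_j=0$ if $|i-j|>1$ and $E_iA^*E_j\ne0$ if $|i-j|=1$; (v) for $0\le i,j\le d$, $E^*_iAE^*_j=0$ if $|i-j|>1$ and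 $E^*_iAE^*_j\neq0$ if $|i-j|=1$. Parameter array. $\theta_i$ (resp. $\theta^*_i$) is the eigenvalue of $A$ (resp. $A^*$) associated with $E_i$ (resp. $E^*_i$). For $0\le i\le d$ define polynomials $\tau_i=(\lambda-\theta_0)(\lambda-\theta_1)\cdots(\lambda-\theta_{i-1})$, $\eta_i=(\lambda-\theta_d)(\lambda-\theta_{d-1})\cdots(\lambda-\theta_{d-i+1})$, $\tau^*_i=(\lambda-\theta^*_0)(\lambda-\theta^*_1)\cdots(\lambda-\theta^*_{i-1})$, $\eta^*_i=(\lambda-\theta^*_d)(\lambda-\theta^*_{d-1})\cdots(\lambda-\theta^*_{d-i+1})$. For $1\le i\le d$ define $\varphi_i=(\theta^*_0-\theta^*_i)\frac{\mathrm{tr}(\tau_i(A)E^*_0)}{\mathrm{tr}(\tau_{i-1}(A)E^*_0)}$ and $\phi_i=(\theta^*_0-\theta^*_i)\frac{\mathrm{tr}(\eta_i(A)E^*_0)}{\mathrm{tr}(\eta_{i-1}(A)E^*_0)}$; the denominators, and all $\varphi_i,\phi_i$, are known to be nonzero. The parameter array of $\Phi$ is $(\{\theta_i\}_{i=0}^d;\{\theta^*_i\}_{i=0}^d;\{\varphi_i\}_{i=1}^d;\{\phi_i\}_{i=1}^d)$. Abbreviate $\varphi=\varphi_1\varphi_2\cdots\varphi_d$ and $\phi=\phi_1\phi_2\cdots\phi_d$. Empty products are $1$. Bilinear form. There is a unique antiautomorphism $\dagger$ of $\mathcal{A}$ ($\mathbb{K}$-linear bijection with $(XY)^\dagger=Y^\dagger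 X^\dagger$) with $A^\dagger=A$ and $A^{*\dagger}=A^*$. $\langle\,,\rangle$ denotes a fixed nonzero bilinear form on $V$ with $\langle Xu,v\rangle=\langle u,X^\dagger v\rangle$ for all $X\in\mathcal{A}$, $u,v\in V$; it exists, is unique up to a nonzero scalar factor, and is nondegenerate and symmetric. All scalars appearing in denominators (traces and inner products) are known to be nonzero. The notation $T\cdot v$ means the element $T\in\mathcal{A}$ (including the scalar prefactor and the whole sum) applied to $v\in V$. *)

theory Defs
  imports "HOL-Computational_Algebra.Polynomial" "Jordan_Normal_Form.Char_Poly"
begin

text \<open>
  The field is the type \<open>'k\<close>, the algebra the type \<open>'a\<close> with scalar multiplication \<open>sA\<close>, and the
  module the type \<open>'v\<close> with scalar multiplication \<open>sV\<close>.
\<close>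

locale assoc_algebra = Vector_Spaces.vector_space sA
  for sA :: "'k::field \<Rightarrow> 'a::ring_1 \<Rightarrow> 'a" +
  assumes scale_mult_left: "sA c X * Y = sA c (X * Y)"
    and scale_mult_right: "X * sA c Y = sA c (X * Y)"

text \<open>
  \<open>\<iota>\<close> is an algebra isomorphism onto the full matrix algebra. Traces and eigenvalues of elements of
  \<open>'a\<close> are read off through \<open>\<iota>\<close>; by Skolem-Noether they do not depend on the choice of \<open>\<iota>\<close>.
\<close>

locale full_matrix_algebra = assoc_algebra sA
  for d :: nat and sA :: "'k::field \<Rightarrow> 'a::ring_1 \<Rightarrow> 'a" and \<iota> :: "'a \<Rightarrow> 'k mat" +
  assumes iso_bij: "bij_betw \<iota> UNIV (carrier_mat (d + 1) (d + 1))"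
    and iso_add: "\<iota> (X + Y) = \<iota> X + \<iota> Y"
    and iso_scale: "\<iota> (sA c X) = c \<cdot>\<^sub>m \<iota> X"
    and iso_mult: "\<iota> (X * Y) = \<iota> X * \<iota> Y"
    and iso_one: "\<iota> 1 = 1\<^sub>m (d + 1)"

locale irreducible_left_module = assoc_algebra sA + V: Vector_Spaces.vector_space sV
  for sA :: "'k::field \<Rightarrow> 'a::ring_1 \<Rightarrow> 'a" and sV :: "'k \<Rightarrow> 'v::ab_group_add \<Rightarrow> 'v"
    and act :: "'a \<Rightarrow> 'v \<Rightarrow> 'v" +
  assumes act_add_left: "act (X + Y) v = act X v + act Y v"
    and act_add_right: "act X (u + v) = act X u + act X v"
    and act_scale_left: "act (sA c X) v = sV c (act X v)"
    and act_scale_right: "act X (sV c v) = sV c (act X v)"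
    and act_mult: "act (X * Y) v = act X (act Y v)"
    and act_one: "act 1 v = v"
    and nontrivial: "\<exists>v::'v. v \<noteq> 0"
    and irreducible:
      "\<lbrakk>V.subspace W; \<And>X w. w \<in> W \<Longrightarrow> act X w \<in> W\<rbrakk> \<Longrightarrow> W = {0} \<or> W = UNIV"

definition mat_trace :: "'k::comm_monoid_add mat \<Rightarrow> 'k" where
  "mat_trace M = (\<Sum>i<dim_row M. M $$ (i, i))"

definition tr :: "('a \<Rightarrow> 'k::field mat) \<Rightarrow> 'a \<Rightarrow> 'k" where
  "tr \<iota> X = mat_trace (\<iota> X)"

definition multiplicity_free :: "nat \<Rightarrow> ('a \<Rightarrow> 'k::field mat) \<Rightarrow> 'a \<Rightarrow> bool" where
  "multiplicity_free d \<iota> X \<longleftrightarrow> card {t. eigenvalue (\<iota> X) t} = d + 1"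

definition eigenvalue_ordering ::
    "nat \<Rightarrow> ('a \<Rightarrow> 'k::field mat) \<Rightarrow> 'a \<Rightarrow> (nat \<Rightarrow> 'k) \<Rightarrow> bool" where
  "eigenvalue_ordering d \<iota> X \<theta> \<longleftrightarrow> bij_betw \<theta> {..d} {t. eigenvalue (\<iota> X) t}"

text \<open>A list product, because the ambient ring is not commutative; the factors commute.\<close>

definition primitive_idempotent ::
    "nat \<Rightarrow> ('k::field \<Rightarrow> 'a::ring_1 \<Rightarrow> 'a) \<Rightarrow> 'a \<Rightarrow> (nat \<Rightarrow> 'k) \<Rightarrow> nat \<Rightarrow> 'a" where
  "primitive_idempotent d sA X \<theta> i =
     (\<Prod>j\<leftarrow>filter (\<lambda>j. j \<noteq> i) [0..<d + 1]. sA (1 / (\<theta> i - \<theta> j)) (X - sA (\<theta> j) 1))"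

text \<open>\<open>\<theta> i\<close> is the eigenvalue of \<open>X\<close> associated with \<open>E i\<close>, for all \<open>i \<le> d\<close>.\<close>

definition associated_eigenvalues ::
    "nat \<Rightarrow> ('k::field \<Rightarrow> 'a::ring_1 \<Rightarrow> 'a) \<Rightarrow> ('a \<Rightarrow> 'k mat) \<Rightarrow> 'a \<Rightarrow> (nat \<Rightarrow> 'a) \<Rightarrow> (nat \<Rightarrow> 'k) \<Rightarrow> bool"
  where
  "associated_eigenvalues d sA \<iota> X E \<theta> \<longleftrightarrow>
     eigenvalue_ordering d \<iota> X \<theta> \<and> (\<forall>i\<le>d. E i = primitive_idempotent d sA X \<theta> i)"

definition leonard_system ::
    "nat \<Rightarrow> ('k::field \<Rightarrow> 'a::ring_1 \<Rightarrow> 'a) \<Rightarrow> ('a \<Rightarrow> 'k mat) \<Rightarrow>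
     'a \<Rightarrow> (nat \<Rightarrow> 'a) \<Rightarrow> 'a \<Rightarrow> (nat \<Rightarrow> 'a) \<Rightarrow> bool" where
  "leonard_system d sA \<iota> A E As Es \<longleftrightarrow>
     multiplicity_free d \<iota> A \<and> multiplicity_free d \<iota> As \<and>
     (\<exists>\<theta>. associated_eigenvalues d sA \<iota> A E \<theta>) \<and>
     (\<exists>\<theta>s. associated_eigenvalues d sA \<iota> As Es \<theta>s) \<and>
     (\<forall>i\<le>d. \<forall>j\<le>d. (\<bar>int i - int j\<bar> > 1 \<longrightarrow> E i * As * E j = 0) \<and>
                   (\<bar>int i - int j\<bar> = 1 \<longrightarrow> E i * As * E j \<noteq> 0)) \<and>
     (\<forall>i\<le>d. \<forall>j\<le>d. (\<bar>int i - int j\<bar> > 1 \<longrightarrow> Es i * A * Es j = 0) \<and>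
                   (\<bar>int i - int j\<bar> = 1 \<longrightarrow> Es i * A * Es j \<noteq> 0))"

definition tau :: "(nat \<Rightarrow> 'k::field) \<Rightarrow> nat \<Rightarrow> 'k poly" where
  "tau \<theta> i = (\<Prod>j<i. [:- \<theta> j, 1:])"

definition eta :: "nat \<Rightarrow> (nat \<Rightarrow> 'k::field) \<Rightarrow> nat \<Rightarrow> 'k poly" where
  "eta d \<theta> i = (\<Prod>j<i. [:- \<theta> (d - j), 1:])"

text \<open>Evaluation of a polynomial at an element of the (noncommutative) algebra.\<close>

definition alg_poly :: "('k::field \<Rightarrow> 'a::ring_1 \<Rightarrow> 'a) \<Rightarrow> 'k poly \<Rightarrow> 'a \<Rightarrow> 'a" where
  "alg_poly sA p X = (\<Sum>k\<le>degree p. sA (coeff p k) (X ^ k))"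

definition parameter_array ::
    "nat \<Rightarrow> ('k::field \<Rightarrow> 'a::ring_1 \<Rightarrow> 'a) \<Rightarrow> ('a \<Rightarrow> 'k mat) \<Rightarrow>
     'a \<Rightarrow> (nat \<Rightarrow> 'a) \<Rightarrow> 'a \<Rightarrow> (nat \<Rightarrow> 'a) \<Rightarrow>
     (nat \<Rightarrow> 'k) \<Rightarrow> (nat \<Rightarrow> 'k) \<Rightarrow> (nat \<Rightarrow> 'k) \<Rightarrow> (nat \<Rightarrow> 'k) \<Rightarrow> bool" where
  "parameter_array d sA \<iota> A E As Es \<theta> \<theta>s \<phi>\<^sub>1 \<phi>\<^sub>2 \<longleftrightarrow>
     associated_eigenvalues d sA \<iota> A E \<theta> \<and>
     associated_eigenvalues d sA \<iota> As Es \<theta>s \<and>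
     (\<forall>i\<in>{1..d}. \<phi>\<^sub>1 i = (\<theta>s 0 - \<theta>s i) *
        (tr \<iota> (alg_poly sA (tau \<theta> i) A * Es 0) / tr \<iota> (alg_poly sA (tau \<theta> (i - 1)) A * Es 0))) \<and>
     (\<forall>i\<in>{1..d}. \<phi>\<^sub>2 i = (\<theta>s 0 - \<theta>s i) *
        (tr \<iota> (alg_poly sA (eta d \<theta> i) A * Es 0) / tr \<iota> (alg_poly sA (eta d \<theta> (i - 1)) A * Es 0)))"

definition antiautomorphism :: "('k::field \<Rightarrow> 'a::ring_1 \<Rightarrow> 'a) \<Rightarrow> ('a \<Rightarrow> 'a) \<Rightarrow> bool" where
  "antiautomorphism sA \<sigma> \<longleftrightarrow>
     Vector_Spaces.linear sA sA \<sigma> \<and> bij \<sigma> \<and> (\<forall>X Y. \<sigma> (X * Y) = \<sigma> Y * \<sigma> X)"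

definition bilinear_form ::
    "('k::field \<Rightarrow> 'v::ab_group_add \<Rightarrow> 'v) \<Rightarrow> ('v \<Rightarrow> 'v \<Rightarrow> 'k) \<Rightarrow> bool" where
  "bilinear_form sV B \<longleftrightarrow>
     (\<forall>u. Vector_Spaces.linear sV (*) (\<lambda>v. B u v)) \<and> (\<forall>v. Vector_Spaces.linear sV (*) (\<lambda>u. B u v))"

end

theory Submission
  imports Defs
begin

text \<open>
  Applied to \<open>E i \<diamondop> \<xi>\<close>, each of the sums over \<open>r\<close> keeps only the term \<open>r = i\<close>, because
  \<open>E r * E i = 0\<close> for \<open>r \<noteq> i\<close>. The leading factor \<open>X i\<close> of this term acts last, so every identity
  arises by applying \<open>X i\<close> to an identity between vectors which is the same for all sequences \<open>X\<close>;
  the reversed identities are the direct ones for the sequence \<open>X (d - i)\<close>. What has to be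
  understood is how \<open>Es d\<close> and \<open>Es 0\<close> act on \<open>E i \<diamondop> \<xi>sd\<close>.

  The primitive idempotents of a multiplicity-free element are rank one matrices \<open>F\<close>. Hence
  \<open>F Z F = tr (Z F) F\<close> for all \<open>Z\<close>, and \<open>Y F Z = 0\<close> forces \<open>Y F = 0\<close> or \<open>F Z = 0\<close>. The first property
  gives \<open>Es d \<diamondop> E i \<diamondop> \<xi>sd = tr (E i Es d) \<xi>sd\<close>, from which all identities involving \<open>Es d\<close> follow;
  for those that also contain \<open>E 0\<close> or \<open>E d\<close> one projects \<open>\<xi>sd\<close> to the line of that idempotent, and
  the coefficient is a quotient of inner products since the idempotents are self-adjoint.

  For the identities with \<open>Es 0\<close>, the element \<open>\<tau>\<^sub>i(\<theta>\<^sub>i) \<eta>\<^bsub>d-i\<^esub>(\<theta>\<^sub>i) E i\<close> equals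
  \<open>(\<tau>\<^sub>i \<eta>\<^bsub>d-i\<^esub>)(A)\<close>, a monic polynomial of degree \<open>d\<close> in \<open>A\<close>. As \<open>A\<close> is tridiagonal with respect to
  the \<open>Es i\<close>, only the leading term survives between \<open>Es 0\<close> and \<open>Es d\<close>; thus
  \<open>\<tau>\<^sub>i(\<theta>\<^sub>i) \<eta>\<^bsub>d-i\<^esub>(\<theta>\<^sub>i) Es 0 E i Es d = Es 0 A\<^sup>d Es d\<close> does not depend on \<open>i\<close>
  (lemma \<open>end_to_end_idempotent\<close>). The constant is then computed for \<open>i = d\<close>, where the product
  \<open>\<phi>\<^sub>1 \<dots> \<phi>\<^sub>d\<close> telescopes to \<open>\<eta>\<^sup>*\<^sub>d(\<theta>\<^sup>*\<^sub>0) tr (\<tau>\<^sub>d(A) Es 0)\<close> (lemma \<open>prod_first_split\<close>).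

  The denominators are nonzero for the same reasons. Tridiagonality makes \<open>Es 0 E i Es d\<close> and
  \<open>Es d E i Es 0\<close> nonzero, and with the rank one property this gives \<open>tr (E i Es d) \<noteq> 0\<close>; playing
  the two tridiagonal structures against each other gives \<open>tr (\<tau>\<^sub>i(A) Es 0) \<noteq> 0\<close>
  (lemma \<open>trace_tau_nonzero\<close>).
\<close>

section \<open>Polynomials in an algebra element\<close>

context assoc_algebra
begin

lemma alg_poly_0: "alg_poly sA 0 X = 0"
  by (simp add: alg_poly_def)

lemma alg_poly_pCons: "alg_poly sA (pCons c p) X = sA c 1 + X * alg_poly sA p X"
proof (cases "p = 0")
  case True
  then show ?thesis by (simp add: alg_poly_def)
next
  case False
  then have "alg_poly sA (pCons c p) X =
      sA c 1 + (\<Sum>k\<le>degree p. sA (coeff p k) (X * X ^ k))"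
    unfolding alg_poly_def by (simp add: sum.atMost_Suc_shift del: sum.atMost_Suc)
  then show ?thesis
    by (simp add: alg_poly_def sum_distrib_left scale_mult_right)
qed

lemma alg_poly_add: "alg_poly sA (p + q) X = alg_poly sA p X + alg_poly sA q X"
  by (induction p q rule: poly_induct2)
    (simp_all add: alg_poly_0 alg_poly_pCons scale_left_distrib distrib_left)

lemma alg_poly_smult: "alg_poly sA (Polynomial.smult c p) X = sA c (alg_poly sA p X)"
  by (induction p) (simp_all add: alg_poly_0 alg_poly_pCons scale_right_distrib scale_mult_right)

lemma alg_poly_mult: "alg_poly sA (p * q) X = alg_poly sA p X * alg_poly sA q X"
  by (induction p)
    (simp_all add: alg_poly_0 alg_poly_pCons alg_poly_add alg_poly_smult distrib_right
      scale_mult_left mult.assoc)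

lemma alg_poly_const: "alg_poly sA [:c:] X = sA c 1"
  by (simp add: alg_poly_0 alg_poly_pCons)

lemma alg_poly_1: "alg_poly sA 1 X = 1"
  using alg_poly_const[of 1] by (simp add: one_pCons)

lemma alg_poly_linear: "alg_poly sA [:- c, 1:] X = X - sA c 1"
  by (simp add: alg_poly_0 alg_poly_pCons)

lemma alg_poly_prod_list:
  "alg_poly sA (prod_list ps) X = prod_list (map (\<lambda>p. alg_poly sA p X) ps)"
  by (induction ps) (simp_all add: alg_poly_1 alg_poly_mult)

lemma sandwich_alg_poly:
  "Y * alg_poly sA p X * Z = (\<Sum>k\<le>degree p. sA (coeff p k) (Y * X ^ k * Z))"
  by (simp add: alg_poly_def sum_distrib_left sum_distrib_right scale_mult_left scale_mult_right)

lemma antiautomorphism_alg_poly: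
  assumes "antiautomorphism sA \<sigma>" and "\<sigma> X = X"
  shows "\<sigma> (alg_poly sA p X) = alg_poly sA p X"
proof -
  have lin: "Vector_Spaces.linear sA sA \<sigma>" and mult: "\<sigma> (Y * Z) = \<sigma> Z * \<sigma> Y" for Y Z
    using assms(1) by (auto simp: antiautomorphism_def)
  obtain Y where Y: "\<sigma> Y = 1"
    using assms(1) by (metis antiautomorphism_def bij_pointE)
  have one: "\<sigma> 1 = 1"
    using mult[of Y 1] Y by simp
  have pow: "\<sigma> (X ^ k) = X ^ k" for k
    by (induction k) (simp_all add: one mult assms(2) power_commutes)
  interpret \<sigma>: Vector_Spaces.linear sA sA \<sigma>
    by (rule lin)
  show ?thesis
    by (simp add: alg_poly_def \<sigma>.sum \<sigma>.scale pow)
qed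

end

lemma degree_prod_linear: "finite J \<Longrightarrow> degree (\<Prod>j\<in>J. [:- f j, 1:] :: 'b::field poly) = card J"
  by (subst degree_prod_eq_sum_degree) auto

lemma lead_coeff_prod_linear: "lead_coeff (\<Prod>j\<in>J. [:- f j, 1:] :: 'b::field poly) = 1"
  by (simp add: lead_coeff_prod)

section \<open>Rank one elements of a full matrix algebra\<close>

context full_matrix_algebra
begin

text \<open>
  Rank at most one: the zero element is included.
\<close>

definition rank_one :: "'a \<Rightarrow> bool" where
  "rank_one F \<longleftrightarrow> (\<exists>x y. \<iota> F = mat (d + 1) (d + 1) (\<lambda>(r, s). x r * y s))"

lemma iso_carrier [simp]: "\<iota> X \<in> carrier_mat (d + 1) (d + 1)"
  using iso_bij by (auto simp: bij_betw_def)

lemma iso_dim [simp]: "dim_row (\<iota> X) = d + 1" "dim_col (\<iota> X) = d + 1"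
  using iso_carrier[of X] by (simp_all only: carrier_matD)

lemma iso_inject: "\<iota> X = \<iota> Y \<longleftrightarrow> X = Y"
  using iso_bij by (auto simp: bij_betw_def inj_on_def)

lemma iso_eqI:
  assumes "\<And>r s. r < d + 1 \<Longrightarrow> s < d + 1 \<Longrightarrow> \<iota> X $$ (r, s) = \<iota> Y $$ (r, s)"
  shows "X = Y"
  unfolding iso_inject[symmetric] by (rule eq_matI) (simp_all add: assms)

lemma iso_mult_entry:
  assumes "r < d + 1" and "s < d + 1"
  shows "\<iota> (X * Y) $$ (r, s) = (\<Sum>k<d + 1. \<iota> X $$ (r, k) * \<iota> Y $$ (k, s))"
  using assms by (simp add: iso_mult scalar_prod_def lessThan_atLeast0)

lemma iso_scale_entry:
  assumes "r < d + 1" and "s < d + 1"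
  shows "\<iota> (sA c X) $$ (r, s) = c * \<iota> X $$ (r, s)"
  using assms by (simp add: iso_scale)

lemma iso_zero_entry:
  assumes "r < d + 1" and "s < d + 1"
  shows "\<iota> 0 $$ (r, s) = 0"
  using iso_scale_entry[OF assms, of 0 0] by simp

lemma iso_zero: "\<iota> 0 = 0\<^sub>m (d + 1) (d + 1)"
  by (rule eq_matI) (auto simp: iso_zero_entry)

text \<open>
  For \<open>F = x y\<^sup>T\<close> one has \<open>F Z F = x (y\<^sup>T Z x) y\<^sup>T\<close>, and the scalar \<open>y\<^sup>T Z x\<close> is the trace of
  \<open>Z x y\<^sup>T\<close>. This is the way traces enter all later computations.
\<close>

lemma rank_one_sandwich:
  assumes "rank_one F"
  shows "F * Z * F = sA (tr \<iota> (Z * F)) F"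
proof -
  obtain x y where xy: "\<iota> F = mat (d + 1) (d + 1) (\<lambda>(r, s). x r * y s)"
    using assms by (auto simp: rank_one_def)
  have F: "\<iota> F $$ (r, s) = x r * y s" if "r < d + 1" "s < d + 1" for r s
    using that by (simp add: xy)
  have tr: "tr \<iota> (Z * F) = (\<Sum>r<d + 1. \<Sum>k<d + 1. \<iota> Z $$ (r, k) * (x k * y r))"
    unfolding tr_def mat_trace_def iso_dim
    by (intro sum.cong refl) (simp add: iso_mult_entry F del: sum.lessThan_Suc)
  show ?thesis
  proof (rule iso_eqI)
    fix r s assume rs: "r < d + 1" "s < d + 1"
    have "\<iota> (F * Z * F) $$ (r, s)
        = (\<Sum>k<d + 1. (\<Sum>l<d + 1. x r * y l * \<iota> Z $$ (l, k)) * (x k * y s))"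
      using rs by (simp add: iso_mult_entry F del: sum.lessThan_Suc)
    also have "\<dots> = (\<Sum>k<d + 1. \<Sum>l<d + 1. \<iota> Z $$ (l, k) * (x k * y l)) * (x r * y s)"
      by (simp add: sum_distrib_left sum_distrib_right mult_ac del: sum.lessThan_Suc)
    also have "\<dots> = tr \<iota> (Z * F) * (x r * y s)"
      unfolding tr by (subst sum.swap) (rule refl)
    also have "\<dots> = \<iota> (sA (tr \<iota> (Z * F)) F) $$ (r, s)"
      using rs by (simp add: iso_scale_entry F)
    finally show "\<iota> (F * Z * F) $$ (r, s) = \<iota> (sA (tr \<iota> (Z * F)) F) $$ (r, s)" .
  qed
qed

text \<open>
  If \<open>F = x y\<^sup>T\<close> then \<open>Y F Z = (Y x) (y\<^sup>T Z)\<close> is an outer product of two nonzero vectors.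
  Nonvanishing of products of idempotents with tridiagonal elements always comes from this lemma.
\<close>

lemma rank_one_prime:
  assumes "rank_one F" and "Y * F \<noteq> 0" and "F * Z \<noteq> 0"
  shows "Y * F * Z \<noteq> 0"
proof -
  obtain x y where xy: "\<iota> F = mat (d + 1) (d + 1) (\<lambda>(r, s). x r * y s)"
    using assms(1) by (auto simp: rank_one_def)
  have F: "\<iota> F $$ (r, s) = x r * y s" if "r < d + 1" "s < d + 1" for r s
    using that by (simp add: xy)
  define Yx where "Yx r = (\<Sum>k<d + 1. \<iota> Y $$ (r, k) * x k)" for r
  define yZ where "yZ s = (\<Sum>k<d + 1. y k * \<iota> Z $$ (k, s))" for s
  have YF: "\<iota> (Y * F) $$ (r, s) = Yx r * y s" if "r < d + 1" "s < d + 1" for r s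
    using that by (simp add: iso_mult_entry F Yx_def sum_distrib_left sum_distrib_right mult_ac
        del: sum.lessThan_Suc)
  have FZ: "\<iota> (F * Z) $$ (r, s) = x r * yZ s" if "r < d + 1" "s < d + 1" for r s
    using that by (simp add: iso_mult_entry F yZ_def sum_distrib_left sum_distrib_right mult_ac
        del: sum.lessThan_Suc)
  have YFZ: "\<iota> (Y * F * Z) $$ (r, s) = Yx r * yZ s" if "r < d + 1" "s < d + 1" for r s
    using that unfolding iso_mult_entry[OF that, of "Y * F"]
    by (simp add: YF yZ_def sum_distrib_left sum_distrib_right mult_ac
        del: sum.lessThan_Suc)
  obtain r where r: "r < d + 1" "Yx r \<noteq> 0"
    using assms(2) iso_eqI[of "Y * F" 0] by (auto simp: YF iso_zero_entry)
  obtain s where s: "s < d + 1" "yZ s \<noteq> 0"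
    using assms(3) iso_eqI[of "F * Z" 0] by (auto simp: FZ iso_zero_entry)
  show ?thesis
    using YFZ[OF r(1) s(1)] iso_zero_entry[OF r(1) s(1)] r(2) s(2) by auto
qed

end

section \<open>Primitive idempotents of a multiplicity-free element\<close>

locale multiplicity_free_element = full_matrix_algebra d sA \<iota>
  for d and sA :: "'k::field \<Rightarrow> 'a::ring_1 \<Rightarrow> 'a" and \<iota> +
  fixes X :: 'a and F :: "nat \<Rightarrow> 'a" and \<theta> :: "nat \<Rightarrow> 'k"
  assumes eigenvalues: "associated_eigenvalues d sA \<iota> X F \<theta>"
begin

lemma eigenvalue_distinct: "i \<le> d \<Longrightarrow> j \<le> d \<Longrightarrow> \<theta> i = \<theta> j \<longleftrightarrow> i = j"
  using eigenvalues
  by (auto simp: associated_eigenvalues_def eigenvalue_ordering_def bij_betw_def inj_on_def)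

lemma alg_poly_eigenvector:
  assumes "v \<in> carrier_vec (d + 1)" and "\<iota> X *\<^sub>v v = t \<cdot>\<^sub>v v"
  shows "\<iota> (alg_poly sA p X) *\<^sub>v v = poly p t \<cdot>\<^sub>v v"
proof (induction p)
  case 0
  show ?case
    using assms(1) by (intro eq_vecI) (auto simp: alg_poly_0 iso_zero)
next
  case (pCons c p)
  have scalar: "(c \<cdot>\<^sub>m 1\<^sub>m (d + 1)) *\<^sub>v v = c \<cdot>\<^sub>v v"
    using assms(1) by (intro eq_vecI) auto
  have "\<iota> (alg_poly sA (pCons c p) X) *\<^sub>v v
      = (c \<cdot>\<^sub>m 1\<^sub>m (d + 1)) *\<^sub>v v + (\<iota> X * \<iota> (alg_poly sA p X)) *\<^sub>v v"
    unfolding alg_poly_pCons iso_add iso_scale iso_one iso_mult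
    using assms(1) by (intro add_mult_distrib_mat_vec[of _ "d + 1" "d + 1"]) auto
  also have "(\<iota> X * \<iota> (alg_poly sA p X)) *\<^sub>v v = \<iota> X *\<^sub>v (poly p t \<cdot>\<^sub>v v)"
    using assms(1) pCons.IH by (subst assoc_mult_mat_vec[of _ "d + 1" "d + 1" _ "d + 1"]) auto
  also have "\<dots> = poly p t \<cdot>\<^sub>v (t \<cdot>\<^sub>v v)"
    using assms by (subst mult_mat_vec[of _ "d + 1" "d + 1"]) auto
  finally show ?case
    unfolding scalar using assms(1) by (intro eq_vecI) (auto simp: algebra_simps)
qed

text \<open>
  The columns of \<open>P\<close> are eigenvectors for \<open>\<theta> 0, \<dots>, \<theta> d\<close>. They are independent because a
  polynomial vanishing at all eigenvalues but \<open>\<theta> i\<close>, applied to a linear relation, isolates the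
  \<open>i\<close>-th coefficient.
\<close>

lemma ex_diagonalization:
  obtains P Q where "P \<in> carrier_mat (d + 1) (d + 1)" and "Q \<in> carrier_mat (d + 1) (d + 1)"
    and "P * Q = 1\<^sub>m (d + 1)" and "Q * P = 1\<^sub>m (d + 1)"
    and "\<And>p. \<iota> (alg_poly sA p X) * P = P * mat_diag (d + 1) (\<lambda>i. poly p (\<theta> i))"
proof -
  have "\<exists>v. v \<in> carrier_vec (d + 1) \<and> v \<noteq> 0\<^sub>v (d + 1) \<and> \<iota> X *\<^sub>v v = \<theta> i \<cdot>\<^sub>v v" if "i \<le> d" for i
  proof -
    have "eigenvalue (\<iota> X) (\<theta> i)"
      using eigenvalues that
      by (auto simp: associated_eigenvalues_def eigenvalue_ordering_def bij_betw_def)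
    then show ?thesis
      by (auto simp: eigenvalue_def eigenvector_def)
  qed
  then obtain v where v: "\<And>i. i \<le> d \<Longrightarrow> v i \<in> carrier_vec (d + 1)"
    "\<And>i. i \<le> d \<Longrightarrow> v i \<noteq> 0\<^sub>v (d + 1)" "\<And>i. i \<le> d \<Longrightarrow> \<iota> X *\<^sub>v v i = \<theta> i \<cdot>\<^sub>v v i"
    by metis
  define P where "P = mat (d + 1) (d + 1) (\<lambda>(r, c). v c $ r)"
  have P: "P \<in> carrier_mat (d + 1) (d + 1)"
    by (simp add: P_def)
  have col_P: "col P c = v c" if "c \<le> d" for c
    using v(1)[OF that] that by (intro eq_vecI) (auto simp: P_def)
  have diag: "\<iota> (alg_poly sA p X) * P = P * mat_diag (d + 1) (\<lambda>i. poly p (\<theta> i))" for p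
  proof (rule mat_col_eqI)
    fix c assume "c < dim_col (P * mat_diag (d + 1) (\<lambda>i. poly p (\<theta> i)))"
    then have c: "c \<le> d"
      by (simp add: mat_diag_def)
    then have "col (\<iota> (alg_poly sA p X) * P) c = poly p (\<theta> c) \<cdot>\<^sub>v v c"
      using alg_poly_eigenvector[OF v(1,3)[OF c]]
      by (subst col_mult2[OF iso_carrier P]) (auto simp: col_P)
    also have "\<dots> = col (P * mat_diag (d + 1) (\<lambda>i. poly p (\<theta> i))) c"
      unfolding mat_diag_mult_right[OF P]
      using c v(1)[OF c] by (intro eq_vecI) (auto simp: P_def)
    finally show "col (\<iota> (alg_poly sA p X) * P) c
        = col (P * mat_diag (d + 1) (\<lambda>i. poly p (\<theta> i))) c" .
  qed (auto simp: P_def mat_diag_def)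
  have "det P \<noteq> 0"
  proof
    assume "det P = 0"
    then obtain w where w: "w \<in> carrier_vec (d + 1)" "w \<noteq> 0\<^sub>v (d + 1)" "P *\<^sub>v w = 0\<^sub>v (d + 1)"
      unfolding det_0_iff_vec_prod_zero_field[OF P] by blast
    have "w $ i = 0" if i: "i < d + 1" for i
    proof -
      define p where "p = (\<Prod>j\<in>{..d} - {i}. [:- \<theta> j, 1:])"
      have p_zero: "poly p (\<theta> j) = 0" if "j \<le> d" "j \<noteq> i" for j
        using that by (auto simp: p_def poly_prod)
      have p_nz: "poly p (\<theta> i) \<noteq> 0"
        using i by (auto simp: p_def poly_prod eigenvalue_distinct)
      obtain r where r: "r < d + 1" "v i $ r \<noteq> 0"
        using v(1,2)[of i] i by (auto simp: vec_eq_iff)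
      have "(P * mat_diag (d + 1) (\<lambda>i. poly p (\<theta> i))) *\<^sub>v w = \<iota> (alg_poly sA p X) *\<^sub>v (P *\<^sub>v w)"
        unfolding diag[symmetric] using w(1) P by (intro assoc_mult_mat_vec) auto
      then have "0 = ((P * mat_diag (d + 1) (\<lambda>i. poly p (\<theta> i))) *\<^sub>v w) $ r"
        using r(1) by (simp add: w(3) scalar_prod_def)
      also have "\<dots> = (\<Sum>c<d + 1. v c $ r * poly p (\<theta> c) * w $ c)"
        unfolding mat_diag_mult_right[OF P] using r(1) w(1)
        by (simp add: scalar_prod_def P_def lessThan_atLeast0 del: sum.op_ivl_Suc)
      also have "\<dots> = v i $ r * poly p (\<theta> i) * w $ i"
        using i p_zero by (subst sum.remove[of _ i]) (auto intro!: sum.neutral)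
      finally show "w $ i = 0"
        using p_nz r(2) by simp
    qed
    then show False
      using w(1,2) by (metis eq_vecI carrier_vecD index_zero_vec)
  qed
  then have "P \<in> Units (ring_mat TYPE('k) (d + 1) ())"
    by (rule det_non_zero_imp_unit[OF P])
  then obtain Q where "Q \<in> carrier_mat (d + 1) (d + 1)" "P * Q = 1\<^sub>m (d + 1)" "Q * P = 1\<^sub>m (d + 1)"
    by (auto simp: Units_def ring_mat_simps)
  then show ?thesis
    using that P diag by blast
qed

text \<open>
  Evaluation at \<open>X\<close> factors through the values at the eigenvalues, since \<open>X\<close> is diagonalizable. All
  relations among the idempotents reduce in this way to interpolation at \<open>\<theta> 0, \<dots>, \<theta> d\<close>.
\<close>

lemma alg_poly_cong:
  assumes "\<And>i. i \<le> d \<Longrightarrow> poly p (\<theta> i) = poly q (\<theta> i)"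
  shows "alg_poly sA p X = alg_poly sA q X"
proof -
  obtain P Q where PQ: "P \<in> carrier_mat (d + 1) (d + 1)" "Q \<in> carrier_mat (d + 1) (d + 1)"
    "P * Q = 1\<^sub>m (d + 1)"
    and diag: "\<And>p. \<iota> (alg_poly sA p X) * P = P * mat_diag (d + 1) (\<lambda>i. poly p (\<theta> i))"
    using ex_diagonalization by metis
  have decomp: "\<iota> (alg_poly sA p X) = P * mat_diag (d + 1) (\<lambda>i. poly p (\<theta> i)) * Q" for p
    unfolding diag[symmetric] using PQ
    by (simp add: assoc_mult_mat[OF iso_carrier PQ(1,2)] right_mult_one_mat[OF iso_carrier])
  have "mat_diag (d + 1) (\<lambda>i. poly p (\<theta> i)) = mat_diag (d + 1) (\<lambda>i. poly q (\<theta> i))"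
    using assms by (intro eq_matI) (auto simp: mat_diag_def)
  then show ?thesis
    unfolding iso_inject[symmetric] decomp by simp
qed

definition lagrange_poly :: "nat \<Rightarrow> 'k poly" where
  "lagrange_poly i = (\<Prod>j\<in>{..d} - {i}. Polynomial.smult (1 / (\<theta> i - \<theta> j)) [:- \<theta> j, 1:])"

lemma poly_lagrange_poly:
  assumes "i \<le> d" and "k \<le> d"
  shows "poly (lagrange_poly i) (\<theta> k) = (if k = i then 1 else 0)"
proof (cases "k = i")
  case True
  then show ?thesis
    using assms by (auto simp: lagrange_poly_def poly_prod eigenvalue_distinct simp flip: diff_divide_distrib
        intro!: prod.neutral)
next
  case False
  then show ?thesis
    using assms by (auto simp: lagrange_poly_def poly_prod)
qed

lemma idempotent_eq_lagrange:
  assumes "i \<le> d"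
  shows "F i = alg_poly sA (lagrange_poly i) X"
proof -
  let ?js = "filter (\<lambda>j. j \<noteq> i) [0..<d + 1]"
  have "set ?js = {..d} - {i}"
    by auto
  then have "lagrange_poly i
      = prod_list (map (\<lambda>j. Polynomial.smult (1 / (\<theta> i - \<theta> j)) [:- \<theta> j, 1:]) ?js)"
    unfolding lagrange_poly_def 
    by (subst prod.distinct_set_conv_list[symmetric]) auto
  then have "alg_poly sA (lagrange_poly i) X
      = (\<Prod>j\<leftarrow>?js. alg_poly sA (Polynomial.smult (1 / (\<theta> i - \<theta> j)) [:- \<theta> j, 1:]) X)"
    by (simp only: alg_poly_prod_list map_map o_def)
  also have "\<dots> = primitive_idempotent d sA X \<theta> i"
    by (simp only: primitive_idempotent_def alg_poly_smult alg_poly_linear)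
  finally show ?thesis
    using eigenvalues assms by (simp add: associated_eigenvalues_def)
qed

lemma alg_poly_mult_idempotent:
  assumes "i \<le> d"
  shows "alg_poly sA p X * F i = sA (poly p (\<theta> i)) (F i)"
proof -
  have "alg_poly sA (p * lagrange_poly i) X
      = alg_poly sA (Polynomial.smult (poly p (\<theta> i)) (lagrange_poly i)) X"
    using assms by (intro alg_poly_cong) (auto simp: poly_lagrange_poly)
  then show ?thesis
    by (simp add: alg_poly_mult alg_poly_smult idempotent_eq_lagrange[OF assms])
qed

lemma idempotent_mult_alg_poly:
  assumes "i \<le> d"
  shows "F i * alg_poly sA p X = sA (poly p (\<theta> i)) (F i)"
  using alg_poly_mult_idempotent[OF assms]
  by (metis alg_poly_mult assms idempotent_eq_lagrange mult.commute)

lemma idempotent_mult: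
  assumes "i \<le> d" and "j \<le> d"
  shows "F i * F j = (if i = j then F i else 0)"
  using assms alg_poly_mult_idempotent[of j "lagrange_poly i"]
  by (auto simp: poly_lagrange_poly idempotent_eq_lagrange[symmetric])

lemma sum_idempotents: "(\<Sum>i\<le>d. F i) = 1"
proof -
  have "(\<Sum>i\<le>d. F i) = alg_poly sA (\<Sum>i\<le>d. lagrange_poly i) X"
  proof -
    have "alg_poly sA (sum f J) X = (\<Sum>i\<in>J. alg_poly sA (f i) X)" if "finite J" for f and J :: "nat set"
      using that by induction (auto simp: alg_poly_0 alg_poly_add)
    then show ?thesis
      by (simp add: idempotent_eq_lagrange)
  qed
  also have "\<dots> = alg_poly sA 1 X"
    by (intro alg_poly_cong) (auto simp: poly_sum poly_lagrange_poly)
  finally show ?thesis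
    by (simp add: alg_poly_1)
qed

lemma rank_one_idempotent:
  assumes "i \<le> d"
  shows "rank_one (F i)"
proof -
  obtain P Q where PQ: "P \<in> carrier_mat (d + 1) (d + 1)" "Q \<in> carrier_mat (d + 1) (d + 1)"
    "P * Q = 1\<^sub>m (d + 1)"
    and diag: "\<And>p. \<iota> (alg_poly sA p X) * P = P * mat_diag (d + 1) (\<lambda>i. poly p (\<theta> i))"
    using ex_diagonalization by metis
  have "\<iota> (F i) = \<iota> (F i) * P * Q"
    by (simp add: assoc_mult_mat[OF iso_carrier PQ(1,2)] PQ(3) right_mult_one_mat[OF iso_carrier])
  \<comment> \<open>In the eigenbasis the idempotent is a matrix unit, so only column \<open>i\<close> survives.\<close>
  also have "\<iota> (F i) * P = mat (d + 1) (d + 1) (\<lambda>(r, c). if c = i then P $$ (r, i) else 0)"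
    unfolding idempotent_eq_lagrange[OF assms] diag mat_diag_mult_right[OF PQ(1)]
    using assms by (intro eq_matI) (auto simp: poly_lagrange_poly)
  also have "\<dots> * Q = mat (d + 1) (d + 1) (\<lambda>(r, s). P $$ (r, i) * Q $$ (i, s))"
    using PQ(1,2) assms
    by (intro eq_matI) (auto simp: scalar_prod_def if_distrib[of "\<lambda>x. x * _"] simp del: sum.op_ivl_Suc
        cong: if_cong)
  finally have "\<iota> (F i) = mat (d + 1) (d + 1) (\<lambda>(r, s). P $$ (r, i) * Q $$ (i, s))" .
  then show ?thesis
    unfolding rank_one_def by (intro exI[of _ "\<lambda>r. P $$ (r, i)"] exI[of _ "\<lambda>s. Q $$ (i, s)"])
qed

lemma idempotent_nonzero:
  assumes "i \<le> d"
  shows "F i \<noteq> 0"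
proof
  assume zero: "F i = 0"
  obtain P Q where PQ: "P \<in> carrier_mat (d + 1) (d + 1)" "Q \<in> carrier_mat (d + 1) (d + 1)"
    "Q * P = 1\<^sub>m (d + 1)"
    and diag: "\<And>p. \<iota> (alg_poly sA p X) * P = P * mat_diag (d + 1) (\<lambda>i. poly p (\<theta> i))"
    using ex_diagonalization by metis
  let ?D = "mat_diag (d + 1) (\<lambda>j. poly (lagrange_poly i) (\<theta> j))"
  have "?D = Q * P * ?D"
    by (simp add: PQ(3) left_mult_one_mat[OF mat_diag_dim])
  also have "\<dots> = Q * (\<iota> (F i) * P)"
    unfolding idempotent_eq_lagrange[OF assms] diag
    by (rule assoc_mult_mat[OF PQ(2,1) mat_diag_dim])
  also have "\<dots> = 0\<^sub>m (d + 1) (d + 1)"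
    using PQ(1,2) by (simp add: zero iso_zero)
  finally have "?D $$ (i, i) = 0"
    using assms by simp
  then show False
    using assms by (simp add: mat_diag_def poly_lagrange_poly)
qed

lemma idempotent_sandwich: "i \<le> d \<Longrightarrow> F i * Z * F i = sA (tr \<iota> (Z * F i)) (F i)"
  by (intro rank_one_sandwich rank_one_idempotent)

lemma idempotent_prime: "i \<le> d \<Longrightarrow> Y * F i \<noteq> 0 \<Longrightarrow> F i * Z \<noteq> 0 \<Longrightarrow> Y * F i * Z \<noteq> 0"
  by (intro rank_one_prime rank_one_idempotent)

end

section \<open>Irreducible tridiagonal action on a system of idempotents\<close>

definition irreducible_tridiagonal :: "nat \<Rightarrow> (nat \<Rightarrow> 'a::ring_1) \<Rightarrow> 'a \<Rightarrow> bool" where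
  "irreducible_tridiagonal d F Y \<longleftrightarrow>
     (\<forall>i\<le>d. \<forall>j\<le>d. (\<bar>int i - int j\<bar> > 1 \<longrightarrow> F i * Y * F j = 0) \<and>
                   (\<bar>int i - int j\<bar> = 1 \<longrightarrow> F i * Y * F j \<noteq> 0))"

context multiplicity_free_element
begin

text \<open>
  Inserting the resolution of the identity splits a product into its paths through the indices
  \<open>0, \<dots>, d\<close>.
\<close>

lemma mult_insert_idempotents: "Y * Z = (\<Sum>m\<le>d. Y * F m * Z)"
proof -
  have "Y * Z = Y * (\<Sum>m\<le>d. F m) * Z"
    by (simp add: sum_idempotents)
  then show ?thesis
    by (simp only: sum_distrib_left sum_distrib_right)
qed

lemma tridiagonal_power_vanishes:
  assumes "irreducible_tridiagonal d F Y" and "i \<le> d" and "j \<le> d"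
    and "int k < \<bar>int i - int j\<bar>"
  shows "F i * Y ^ k * F j = 0"
  using assms(3,4)
proof (induction k arbitrary: j)
  case 0
  then show ?case
    using assms(2) by (auto simp: idempotent_mult)
next
  case (Suc k)
  have "F i * Y ^ k * F m * (Y * F j) = 0" if "m \<le> d" for m
  proof (cases "int k < \<bar>int i - int m\<bar>")
    case True
    then show ?thesis
      using Suc.IH[OF that] by simp
  next
    case False
    then have "\<bar>int m - int j\<bar> > 1"
      using Suc.prems(2) by linarith
    then have "F m * Y * F j = 0"
      using assms(1) that Suc.prems(1) by (simp add: irreducible_tridiagonal_def)
    then show ?thesis
      by (simp add: mult.assoc)
  qed
  then have "F i * Y ^ k * (Y * F j) = 0"
    by (subst mult_insert_idempotents) (simp add: sum.neutral)
  then show ?case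
    by (simp add: power_Suc2 mult.assoc del: power_Suc)
qed

text \<open>
  Among the paths of length \<open>k\<close> from \<open>j\<close> to \<open>i\<close> with steps of size at most one, only the monotone
  one exists when \<open>\<bar>i - j\<bar> = k\<close>; its contribution is nonzero by \<open>idempotent_prime\<close>.
\<close>

lemma tridiagonal_power_nonzero:
  assumes "irreducible_tridiagonal d F Y" and "i \<le> d" and "j \<le> d"
    and "\<bar>int i - int j\<bar> = int k"
  shows "F i * Y ^ k * F j \<noteq> 0"
  using assms(3,4)
proof (induction k arbitrary: j)
  case 0
  then show ?case
    using assms(2) by (simp add: idempotent_mult idempotent_nonzero)
next
  case (Suc k)
  \<comment> \<open>The neighbour of \<open>j\<close> in the direction of \<open>i\<close>, through which every path must pass.\<close>
  define n where "n = (if i < j then j - 1 else j + 1)"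
  have n: "n \<le> d" "\<bar>int i - int n\<bar> = int k" "\<bar>int n - int j\<bar> = 1"
    using Suc.prems assms(2) by (auto simp: n_def)
  have other: "F i * Y ^ k * F m * (Y * F j) = 0" if "m \<le> d" "m \<noteq> n" for m
  proof (cases "int k < \<bar>int i - int m\<bar>")
    case True
    then show ?thesis
      using tridiagonal_power_vanishes[OF assms(1,2) that(1)] by simp
  next
    case False
    then have "\<bar>int m - int j\<bar> > 1"
      using Suc.prems(2) that(2) by (auto simp: n_def split: if_splits)
    then have "F m * Y * F j = 0"
      using assms(1) that Suc.prems(1) by (simp add: irreducible_tridiagonal_def)
    then show ?thesis
      by (simp add: mult.assoc)
  qed
  have "F i * Y ^ Suc k * F j = F i * Y ^ k * (Y * F j)"
    by (simp add: power_Suc2 mult.assoc del: power_Suc)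
  also have "\<dots> = F i * Y ^ k * F n * (Y * F j)"
    using n(1) other by (subst mult_insert_idempotents, subst sum.remove[of _ n]) auto
  also have "\<dots> \<noteq> 0"
  proof (rule idempotent_prime[OF n(1)])
    show "F i * Y ^ k * F n \<noteq> 0"
      by (rule Suc.IH[OF n(1,2)])
    show "F n * (Y * F j) \<noteq> 0"
      using assms(1) n Suc.prems(1) by (simp add: irreducible_tridiagonal_def mult.assoc)
  qed
  finally show ?case .
qed

lemma tridiagonal_poly_vanishes:
  assumes "irreducible_tridiagonal d F Y" and "i \<le> d" and "j \<le> d"
    and "int (degree p) < \<bar>int i - int j\<bar>"
  shows "F i * alg_poly sA p Y * F j = 0"
  unfolding sandwich_alg_poly using assms
  by (intro sum.neutral) (simp add: tridiagonal_power_vanishes)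

lemma tridiagonal_poly_extreme:
  assumes "irreducible_tridiagonal d F Y" and "i \<le> d" and "j \<le> d"
    and "\<bar>int i - int j\<bar> = int (degree p)" and "lead_coeff p = 1"
  shows "F i * alg_poly sA p Y * F j = F i * Y ^ degree p * F j"
proof -
  have "(\<Sum>k\<in>{..degree p} - {degree p}. sA (coeff p k) (F i * Y ^ k * F j)) = 0"
    using assms by (intro sum.neutral) (auto simp: tridiagonal_power_vanishes)
  then show ?thesis
    unfolding sandwich_alg_poly using assms(5) by (subst sum.remove[of _ "degree p"]) auto
qed

end

section \<open>Traces in a Leonard system\<close>

locale leonard_eigenvalues =
  A: multiplicity_free_element d sA \<iota> A E \<theta> + As: multiplicity_free_element d sA \<iota> As Es \<theta>s
  for d and sA :: "'k::field \<Rightarrow> 'a::ring_1 \<Rightarrow> 'a" and \<iota> and A E \<theta> As Es \<theta>s +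
  assumes tridiagonal_As: "irreducible_tridiagonal d E As"
    and tridiagonal_A: "irreducible_tridiagonal d Es A"
begin

text \<open>
  This is the product of all \<open>\<theta> i - \<theta> j\<close> with \<open>j \<noteq> i\<close>, the denominator of the \<open>i\<close>-th Lagrange
  polynomial.
\<close>

abbreviation node_weight :: "nat \<Rightarrow> 'k" where
  "node_weight i \<equiv> poly (tau \<theta> i) (\<theta> i) * poly (eta d \<theta> (d - i)) (\<theta> i)"

lemma poly_tau_eq_0: "j < i \<Longrightarrow> poly (tau \<theta> i) (\<theta> j) = 0"
  by (auto simp: tau_def poly_prod)

lemma poly_eta_eq_0:
  assumes "i < j" and "j \<le> d"
  shows "poly (eta d \<theta> (d - i)) (\<theta> j) = 0"
  using assms by (auto simp: eta_def poly_prod intro!: bexI[of _ "d - j"])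

lemma poly_tau_nonzero: "i \<le> d \<Longrightarrow> poly (tau \<theta> i) (\<theta> i) \<noteq> 0"
  by (auto simp: tau_def poly_prod A.eigenvalue_distinct)

text \<open>
  Both sides are polynomials in \<open>A\<close>: \<open>\<tau>\<^sub>i\<close> vanishes at \<open>\<theta> j\<close> for \<open>j < i\<close> and \<open>\<eta>\<^bsub>d-i\<^esub>\<close> for \<open>j > i\<close>, so
  their product is a multiple of the Lagrange polynomial at \<open>\<theta> i\<close>.
\<close>

lemma scaled_idempotent:
  assumes "i \<le> d"
  shows "alg_poly sA (tau \<theta> i * eta d \<theta> (d - i)) A = sA (node_weight i) (E i)"
proof -
  have "alg_poly sA (tau \<theta> i * eta d \<theta> (d - i)) A
      = alg_poly sA (Polynomial.smult (node_weight i) (A.lagrange_poly i)) A"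
  proof (rule A.alg_poly_cong)
    fix j assume "j \<le> d"
    then show "poly (tau \<theta> i * eta d \<theta> (d - i)) (\<theta> j)
        = poly (Polynomial.smult (node_weight i) (A.lagrange_poly i)) (\<theta> j)"
      using assms poly_tau_eq_0[of j i] poly_eta_eq_0[of i j]
      by (cases i j rule: linorder_cases) (simp_all add: A.poly_lagrange_poly)
  qed
  then show ?thesis
    by (simp add: A.alg_poly_smult A.idempotent_eq_lagrange[OF assms])
qed

text \<open>
  The right-hand side is free of \<open>i\<close>: between the two extreme dual idempotents every monic
  polynomial of degree \<open>d\<close> in \<open>A\<close> looks like \<open>A\<^sup>d\<close>. The ends are kept symmetric in \<open>a\<close> and \<open>b\<close>
  because \<open>(a, b) = (d, 0)\<close> is needed for the nonvanishing results below.
\<close>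

lemma end_to_end_idempotent:
  assumes "i \<le> d" and "a \<le> d" and "b \<le> d" and "\<bar>int a - int b\<bar> = int d"
  shows "sA (node_weight i) (Es a * E i * Es b) = Es a * A ^ d * Es b"
proof -
  let ?p = "tau \<theta> i * eta d \<theta> (d - i)"
  have deg: "degree ?p = d"
    using assms(1) by (subst degree_mult_eq)
      (auto simp: tau_def eta_def degree_prod_linear)
  have lead: "lead_coeff ?p = 1"
    unfolding lead_coeff_mult tau_def eta_def by (simp add: lead_coeff_prod_linear)
  have "sA (node_weight i) (Es a * E i * Es b) = Es a * alg_poly sA ?p A * Es b"
    unfolding scaled_idempotent[OF assms(1)] by (simp add: A.scale_mult_left A.scale_mult_right)
  also have "\<dots> = Es a * A ^ d * Es b"
    using As.tridiagonal_poly_extreme[OF tridiagonal_A assms(2,3), of ?p] assms(4) deg lead by simp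
  finally show ?thesis .
qed

lemma end_idempotent_products_nonzero:
  assumes "i \<le> d" and "a = 0 \<or> a = d"
  shows "Es a * E i \<noteq> 0" and "E i * Es a \<noteq> 0"
proof -
  define b where "b = d - a"
  have ab: "a \<le> d" "b \<le> d" "\<bar>int a - int b\<bar> = int d" "\<bar>int b - int a\<bar> = int d"
    using assms(2) by (auto simp: b_def)
  have "Es a * E i * Es b \<noteq> 0"
    using end_to_end_idempotent[OF assms(1) ab(1-3)]
      As.tridiagonal_power_nonzero[OF tridiagonal_A ab(1-3)] by auto
  then show "Es a * E i \<noteq> 0" by auto
  have "Es b * E i * Es a \<noteq> 0"
    using end_to_end_idempotent[OF assms(1) ab(2,1,4)]
      As.tridiagonal_power_nonzero[OF tridiagonal_A ab(2,1,4)] by auto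
  then show "E i * Es a \<noteq> 0" by (auto simp: mult.assoc)
qed

lemma trace_end_idempotent_nonzero:
  assumes "i \<le> d" and "a = 0 \<or> a = d"
  shows "tr \<iota> (E i * Es a) \<noteq> 0"
proof
  assume "tr \<iota> (E i * Es a) = 0"
  then have "Es a * E i * Es a = 0"
    using assms(2) As.idempotent_sandwich[of a "E i"] by auto
  then show False
    using A.idempotent_prime[OF assms(1) end_idempotent_products_nonzero[OF assms]] by contradiction
qed

text \<open>
  Let \<open>q = (x - \<theta>\<^sup>*\<^sub>1) \<dots> (x - \<theta>\<^sup>*\<^sub>i)\<close> and evaluate \<open>E 0 q(As) \<tau>\<^sub>i(A) Es 0\<close> in two ways.
  Inserting the \<open>Es m\<close> after \<open>q(As)\<close> leaves only \<open>m = 0\<close>: the factor \<open>q\<close> kills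
  \<open>1 \<le> m \<le> i\<close>, and the degree of \<open>\<tau>\<^sub>i\<close> is too small to reach \<open>m > i\<close> from \<open>0\<close>. So the
  product is a multiple of \<open>E 0 Es 0 \<tau>\<^sub>i(A) Es 0\<close> and vanishes with the trace. Inserting the \<open>E m\<close>
  instead leaves only \<open>m = i\<close>: \<open>\<tau>\<^sub>i(A)\<close> kills \<open>m < i\<close>, and the degree of \<open>q\<close> is too small for
  \<open>m > i\<close>. That term is a nonzero multiple of \<open>E 0 As\<^sup>i E i Es 0\<close>, which is nonzero.
\<close>

lemma trace_tau_nonzero:
  assumes "i \<le> d"
  shows "tr \<iota> (alg_poly sA (tau \<theta> i) A * Es 0) \<noteq> 0"
proof
  let ?T = "alg_poly sA (tau \<theta> i) A"
  define q where "q = (\<Prod>j\<in>{1..i}. [:- \<theta>s j, 1:])"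
  let ?Q = "alg_poly sA q As"
  have deg_q: "degree q = i"
    by (simp add: q_def degree_prod_linear)
  have lead_q: "lead_coeff q = 1"
    unfolding q_def by (rule lead_coeff_prod_linear)
  have deg_tau: "degree (tau \<theta> i) = i"
    by (simp add: tau_def degree_prod_linear)
  assume "tr \<iota> (?T * Es 0) = 0"
  then have zero: "Es 0 * ?T * Es 0 = 0"
    using As.idempotent_sandwich[of 0 ?T] by simp
  have "?Q * Es m * (?T * Es 0) = 0" if "m \<le> d" for m
  proof -
    have "poly q (\<theta>s m) = 0" if "1 \<le> m" "m \<le> i"
      using that by (auto simp: q_def poly_prod)
    moreover have "Es m * ?T * Es 0 = 0" if "m > i"
      using that \<open>m \<le> d\<close> deg_tau
      by (intro As.tridiagonal_poly_vanishes[OF tridiagonal_A]) auto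
    ultimately have "sA (poly q (\<theta>s m)) (Es m * ?T * Es 0) = 0"
      using zero by (cases "m = 0"; cases "m \<le> i") auto
    then show ?thesis
      using that by (simp add: As.alg_poly_mult_idempotent A.scale_mult_left mult.assoc)
  qed
  then have QT: "?Q * (?T * Es 0) = 0"
    by (subst As.mult_insert_idempotents) (simp add: sum.neutral)
  have "E 0 * ?Q * E m * (?T * Es 0) = 0" if "m \<le> d" "m \<noteq> i" for m
  proof (cases "m < i")
    case True
    then have "E m * ?T = 0"
      using that by (simp add: A.idempotent_mult_alg_poly poly_tau_eq_0)
    then show ?thesis
      by (metis mult.assoc mult_zero_left mult_zero_right)
  next
    case False
    then have "E 0 * ?Q * E m = 0"
      using that deg_q by (intro A.tridiagonal_poly_vanishes[OF tridiagonal_As]) auto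
    then show ?thesis
      by simp
  qed
  then have "E 0 * ?Q * (?T * Es 0) = E 0 * ?Q * E i * (?T * Es 0)"
    using assms by (subst A.mult_insert_idempotents, subst sum.remove[of _ i]) auto
  also have "\<dots> = E 0 * ?Q * (E i * ?T) * Es 0"
    by (simp add: mult.assoc)
  also have "\<dots> = sA (poly (tau \<theta> i) (\<theta> i)) (E 0 * ?Q * E i * Es 0)"
    using assms by (simp add: A.idempotent_mult_alg_poly A.scale_mult_left A.scale_mult_right)
  finally have "E 0 * ?Q * E i * Es 0 = 0"
    using QT poly_tau_nonzero[OF assms] by (simp add: mult.assoc)
  moreover have "E 0 * ?Q * E i \<noteq> 0"
    using A.tridiagonal_poly_extreme[OF tridiagonal_As, of 0 i q]
      A.tridiagonal_power_nonzero[OF tridiagonal_As, of 0 i i] assms deg_q lead_q by simp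
  ultimately show False
    using A.idempotent_prime[OF assms] end_idempotent_products_nonzero(2)[OF assms] by blast
qed

lemma trace_tau_0: "tr \<iota> (alg_poly sA (tau \<theta> 0) A * Es 0) = 1"
proof -
  have "sA (tr \<iota> (1 * Es 0)) (Es 0) = sA 1 (Es 0)"
    using As.idempotent_sandwich[of 0 1] by (simp add: As.idempotent_mult)
  then show ?thesis
    using As.idempotent_nonzero[of 0] by (simp add: tau_def A.alg_poly_1 del: A.scale_one)
qed

text \<open>
  The quotients of traces telescope, which needs the intermediate traces to be nonzero; the remaining
  factors \<open>\<theta>\<^sup>*\<^sub>0 - \<theta>\<^sup>*\<^sub>j\<close> are those of \<open>\<eta>\<^sup>*\<^sub>d(\<theta>\<^sup>*\<^sub>0)\<close> in reverse order.
\<close>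

lemma prod_first_split:
  assumes "\<And>i. i \<in> {1..d} \<Longrightarrow> \<phi> i = (\<theta>s 0 - \<theta>s i) *
      (tr \<iota> (alg_poly sA (tau \<theta> i) A * Es 0) / tr \<iota> (alg_poly sA (tau \<theta> (i - 1)) A * Es 0))"
  shows "(\<Prod>j=1..d. \<phi> j)
      = poly (eta d \<theta>s d) (\<theta>s 0) * tr \<iota> (alg_poly sA (tau \<theta> d) A * Es 0)"
proof -
  have "(\<Prod>j=1..n. \<phi> j)
      = (\<Prod>j=1..n. \<theta>s 0 - \<theta>s j) * tr \<iota> (alg_poly sA (tau \<theta> n) A * Es 0)" if "n \<le> d" for n
    using that
  proof (induction n)
    case 0
    then show ?case by (simp add: trace_tau_0)
  next
    case (Suc n)
    then show ?case
      using trace_tau_nonzero[of n] by (simp add: assms)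
  qed
  moreover have "poly (eta d \<theta>s d) (\<theta>s 0) = (\<Prod>j=1..d. \<theta>s 0 - \<theta>s j)"
    unfolding eta_def poly_prod
    by (rule prod.reindex_bij_witness[of _ "\<lambda>j. d - j" "\<lambda>j. d - j"]) auto
  ultimately show ?thesis
    by simp
qed

lemma poly_eta_dual_nonzero: "poly (eta d \<theta>s d) (\<theta>s 0) \<noteq> 0"
  by (auto simp: eta_def poly_prod As.eigenvalue_distinct)

end

section \<open>Rank one idempotents on the irreducible module\<close>

context irreducible_left_module
begin

lemma act_zero_left: "act 0 v = 0"
  using act_add_left[of 0 0 v] by simp

lemma act_zero_right: "act Z 0 = 0"
  using act_add_right[of Z 0 0] by simp

lemma cyclic:
  assumes "v \<noteq> 0"
  shows "\<exists>Z. w = act Z v"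
proof -
  let ?W = "range (\<lambda>Z. act Z v)"
  have "V.subspace ?W"
  proof (rule V.subspaceI)
    show "0 \<in> ?W"
      by (metis act_zero_left rangeI)
  qed (auto simp: act_add_left[symmetric] act_scale_left[symmetric])
  moreover have "act Z u \<in> ?W" if "u \<in> ?W" for Z u
    using that by (auto simp: act_mult[symmetric])
  ultimately have "?W = {0} \<or> ?W = UNIV"
    by (rule irreducible)
  moreover have "v \<in> ?W"
    by (rule range_eqI[of _ _ 1]) (simp add: act_one)
  ultimately show ?thesis
    using assms by blast
qed

end

locale leonard_module =
  leonard_eigenvalues d sA \<iota> A E \<theta> As Es \<theta>s + irreducible_left_module sA sV act
  for d and sA :: "'k::field \<Rightarrow> 'a::ring_1 \<Rightarrow> 'a" and \<iota> and A E \<theta> As Es \<theta>s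
    and sV :: "'k \<Rightarrow> 'v::ab_group_add \<Rightarrow> 'v" and act +
  fixes dag :: "'a \<Rightarrow> 'a" and B :: "'v \<Rightarrow> 'v \<Rightarrow> 'k"
  assumes antiaut: "antiautomorphism sA dag" and dag_A: "dag A = A" and dag_As: "dag As = As"
    and bilinear: "bilinear_form sV B" and form_nonzero: "\<exists>u v. B u v \<noteq> 0"
    and adjoint: "B (act X u) v = B u (act (dag X) v)"
begin

lemma linear_form: "Vector_Spaces.linear sV (*) (\<lambda>u. B u v)" "Vector_Spaces.linear sV (*) (B u)"
  using bilinear by (auto simp: bilinear_form_def)

lemma form_add_left: "B (u + u') v = B u v + B u' v"
  using module_hom.add[OF Vector_Spaces.linear.axioms(3)[OF linear_form(1)]] .

lemma form_scale_left: "B (sV c u) v = c * B u v"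
  using module_hom.scale[OF Vector_Spaces.linear.axioms(3)[OF linear_form(1)]] .

lemma form_scale_right: "B u (sV c v) = c * B u v"
  using module_hom.scale[OF Vector_Spaces.linear.axioms(3)[OF linear_form(2)]] .

text \<open>
  The left radical is a submodule by adjointness, hence zero by irreducibility.
\<close>

lemma nondegenerate:
  assumes "\<And>v. B u v = 0"
  shows "u = 0"
proof -
  let ?W = "{u. \<forall>v. B u v = 0}"
  have "B 0 v = 0" for v
    using form_scale_left[of 0 0 v] by simp
  then have "V.subspace ?W"
    by (intro V.subspaceI) (auto simp: form_add_left form_scale_left)
  moreover have "act X w \<in> ?W" if "w \<in> ?W" for X w
    using that by (simp add: adjoint)
  ultimately have "?W = {0} \<or> ?W = UNIV"
    by (rule irreducible)
  moreover have "?W \<noteq> UNIV"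
    using form_nonzero by blast
  ultimately show ?thesis
    using assms by auto
qed

text \<open>
  The image of a rank one idempotent on the irreducible module is a line: writing \<open>w = Z \<xi>\<close>, the
  vector \<open>F w = F Z F \<xi>\<close> is a multiple of \<open>F \<xi> = \<xi>\<close>.
\<close>

lemma act_idempotent_scalar:
  assumes "A.rank_one F" and "act F \<xi> = \<xi>" and "\<xi> \<noteq> 0"
  shows "\<exists>c. act F w = sV c \<xi>"
proof -
  obtain Z where "w = act Z \<xi>"
    using cyclic[OF assms(3)] by blast
  then have "act F w = act (F * Z * F) \<xi>"
    by (simp add: act_mult assms(2))
  also have "\<dots> = sV (tr \<iota> (Z * F)) \<xi>"
    by (simp add: A.rank_one_sandwich[OF assms(1)] act_scale_left assms(2))
  finally show ?thesis
    by blast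
qed

text \<open>
  The form against \<open>\<xi>\<close> factors through the projection \<open>F\<close> to the line of \<open>\<xi>\<close>, so an isotropic \<open>\<xi>\<close>
  would lie in the radical.
\<close>

lemma form_self_nonzero:
  assumes "A.rank_one F" and "dag F = F" and "act F \<xi> = \<xi>" and "\<xi> \<noteq> 0"
  shows "B \<xi> \<xi> \<noteq> 0"
proof
  assume zero: "B \<xi> \<xi> = 0"
  have "B \<xi> v = 0" for v
  proof -
    obtain c where "act F v = sV c \<xi>"
      using act_idempotent_scalar[OF assms(1,3,4)] by blast
    then show ?thesis
      using adjoint[of F \<xi> v] by (simp add: assms(2,3) form_scale_right zero)
  qed
  then show False
    using nondegenerate assms(4) by blast
qed

text \<open>
  Self-adjointness of \<open>F\<close> moves it from one argument of the form to the other. Both orders of the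
  arguments occur later: \<open>B \<xi>d \<xi>s0\<close> gives the projection of \<open>\<xi>s0\<close> to \<open>\<xi>d\<close> as well as that of \<open>\<xi>d\<close> to
  \<open>\<xi>s0\<close>.
\<close>

lemma act_idempotent_eq_form:
  assumes "A.rank_one F" and "dag F = F" and "act F \<xi> = \<xi>" and "\<xi> \<noteq> 0"
  shows "act F v = sV (B \<xi> v / B \<xi> \<xi>) \<xi>" and "act F v = sV (B v \<xi> / B \<xi> \<xi>) \<xi>"
proof -
  obtain c where c: "act F v = sV c \<xi>"
    using act_idempotent_scalar[OF assms(1,3,4)] by blast
  have "B \<xi> v = c * B \<xi> \<xi>"
    using adjoint[of F \<xi> v] by (simp add: assms(2,3) c form_scale_right)
  then show "act F v = sV (B \<xi> v / B \<xi> \<xi>) \<xi>"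
    using form_self_nonzero[OF assms] by (simp add: c)
  have "B v \<xi> = c * B \<xi> \<xi>"
    using adjoint[of F v \<xi>] by (simp add: assms(2,3) c form_scale_left)
  then show "act F v = sV (B v \<xi> / B \<xi> \<xi>) \<xi>"
    using form_self_nonzero[OF assms] by (simp add: c)
qed

lemma dag_idempotent: "i \<le> d \<Longrightarrow> dag (E i) = E i"
  by (simp add: A.idempotent_eq_lagrange A.antiautomorphism_alg_poly[OF antiaut dag_A])

lemma dag_dual_idempotent: "i \<le> d \<Longrightarrow> dag (Es i) = Es i"
  by (simp add: As.idempotent_eq_lagrange A.antiautomorphism_alg_poly[OF antiaut dag_As])

lemma act_scaled_sum:
  assumes "i \<le> d"
  shows "act (\<Sum>r\<le>d. sA (c r) (Y r * E r)) (act (E i) v) = sV (c i) (act (Y i) (act (E i) v))"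
proof -
  have "(\<Sum>r\<le>d. sA (c r) (Y r * E r)) * E i = (\<Sum>r\<le>d. if r = i then sA (c i) (Y i * E i) else 0)"
    unfolding sum_distrib_right using assms
    by (intro sum.cong) (auto simp: A.scale_mult_left mult.assoc A.idempotent_mult)
  then have "(\<Sum>r\<le>d. sA (c r) (Y r * E r)) * E i = sA (c i) (Y i * E i)"
    using assms by simp
  then show ?thesis
    by (metis act_mult act_scale_left)
qed

lemma act_end_idempotent:
  assumes "i \<le> d" and "act (Es d) \<xi> = \<xi>"
  shows "act (Es d) (act (E i) \<xi>) = sV (tr \<iota> (E i * Es d)) \<xi>"
proof -
  have "act (Es d) (act (E i) \<xi>) = act (Es d * E i * Es d) \<xi>"
    by (simp add: act_mult assms(2))
  then show ?thesis
    by (simp add: As.idempotent_sandwich act_scale_left assms(2))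
qed

text \<open>
  The weights \<open>1 / tr (E r Es d)\<close> are exactly those which undo \<open>act_end_idempotent\<close>. With
  \<open>Y r * E 0\<close> or \<open>Y r * E d\<close> in place of \<open>Y r\<close> this also serves the identities for \<open>As\<close>.
\<close>

lemma transition_dual_d:
  assumes "i \<le> d" and "act (Es d) \<xi> = \<xi>"
  shows "act (\<Sum>r\<le>d. sA (1 / tr \<iota> (E r * Es d)) (Y r * Es d * E r)) (act (E i) \<xi>) = act (Y i) \<xi>"
  using assms trace_end_idempotent_nonzero[OF assms(1), of d]
  by (simp add: act_scaled_sum[where Y = "\<lambda>r. Y r * Es d"] act_mult act_end_idempotent
      act_scale_right)

lemma form_end_nonzero:
  assumes "i \<le> d" and "act (E i) \<xi> = \<xi>" and "\<xi> \<noteq> 0" and "act (Es d) \<xi>' = \<xi>'" and "\<xi>' \<noteq> 0"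
  shows "B \<xi> \<xi>' \<noteq> 0"
proof
  assume "B \<xi> \<xi>' = 0"
  then have "act (E i) \<xi>' = 0"
    using act_idempotent_eq_form(1)[OF A.rank_one_idempotent dag_idempotent assms(2,3)] assms(1)
    by simp
  then show False
    using act_end_idempotent[OF assms(1,4)] trace_end_idempotent_nonzero[OF assms(1), of d] assms(5)
    by (simp add: act_zero_right)
qed

lemma transition_primal:
  assumes "i \<le> d" and "j \<le> d" and "act (Es d) \<xi>' = \<xi>'" and "\<xi>' \<noteq> 0"
    and "act (E j) \<xi> = \<xi>" and "\<xi> \<noteq> 0"
  shows "act (sA (B \<xi> \<xi> / B \<xi> \<xi>') (\<Sum>r\<le>d. sA (1 / tr \<iota> (E r * Es d)) (Y r * E j * Es d * E r)))
    (act (E i) \<xi>') = act (Y i) \<xi>"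
proof -
  have "act (E j) \<xi>' = sV (B \<xi> \<xi>' / B \<xi> \<xi>) \<xi>"
    using assms(2,5,6) by (intro act_idempotent_eq_form A.rank_one_idempotent dag_idempotent)
  moreover have "B \<xi> \<xi> \<noteq> 0"
    using assms(2,5,6) form_self_nonzero[OF A.rank_one_idempotent dag_idempotent] by blast
  moreover have "B \<xi> \<xi>' \<noteq> 0"
    using form_end_nonzero[OF assms(2,5,6,3,4)] .
  ultimately show ?thesis
    unfolding act_scale_left transition_dual_d[OF assms(1,3), of "\<lambda>r. Y r * E j"]
    by (simp add: act_mult act_scale_right)
qed

text \<open>
  By \<open>end_to_end_idempotent\<close> the vector \<open>node_weight i \<cdot> (Es 0 \<diamondop> E i \<diamondop> \<xi>sd)\<close> is the same for all \<open>i\<close>, and for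
  \<open>i = d\<close> it is found by projecting \<open>\<xi>sd\<close> to \<open>\<xi>d\<close> and then to \<open>\<xi>s0\<close>. The same two projections,
  started at \<open>\<xi>s0\<close>, express \<open>tr (\<tau>\<^sub>d(A) Es 0)\<close> by inner products; comparing the two makes the
  prefactor cancel.
\<close>

lemma transition_dual_0:
  fixes \<phi> :: "nat \<Rightarrow> 'k"
  assumes split: "\<And>i. i \<in> {1..d} \<Longrightarrow> \<phi> i = (\<theta>s 0 - \<theta>s i) *
      (tr \<iota> (alg_poly sA (tau \<theta> i) A * Es 0) / tr \<iota> (alg_poly sA (tau \<theta> (i - 1)) A * Es 0))"
    and i: "i \<le> d"
    and d: "act (E d) \<xi>d = \<xi>d" "\<xi>d \<noteq> 0"
    and s0: "act (Es 0) \<xi>s0 = \<xi>s0" "\<xi>s0 \<noteq> 0"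
    and sd: "act (Es d) \<xi>sd = \<xi>sd" "\<xi>sd \<noteq> 0"
  shows "act (sA (poly (eta d \<theta>s d) (\<theta>s 0) / (\<Prod>j=1..d. \<phi> j) * (B \<xi>d \<xi>s0 / B \<xi>d \<xi>sd))
      (\<Sum>r\<le>d. sA (node_weight r) (Y r * Es 0 * E r))) (act (E i) \<xi>sd) = act (Y i) \<xi>s0"
proof -
  let ?w = "poly (tau \<theta> d) (\<theta> d)" and ?t = "tr \<iota> (alg_poly sA (tau \<theta> d) A * Es 0)"
  have tau_d: "alg_poly sA (tau \<theta> d) A = sA ?w (E d)"
    using scaled_idempotent[of d] by (simp add: eta_def)
  have E_d: "act (E d) v = sV (B \<xi>d v / B \<xi>d \<xi>d) \<xi>d" for v
    using d by (intro act_idempotent_eq_form A.rank_one_idempotent dag_idempotent) auto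
  have Es_0: "act (Es 0) \<xi>d = sV (B \<xi>d \<xi>s0 / B \<xi>s0 \<xi>s0) \<xi>s0"
    using s0 by (intro act_idempotent_eq_form As.rank_one_idempotent dag_dual_idempotent) auto
  have t_nz: "?t \<noteq> 0"
    using trace_tau_nonzero[of d] by simp
  \<comment> \<open>The trace as the scalar by which \<open>Es 0 \<tau>\<^sub>d(A) Es 0\<close> acts on \<open>\<xi>s0\<close>.\<close>
  have "sV ?t \<xi>s0 = act (Es 0 * alg_poly sA (tau \<theta> d) A * Es 0) \<xi>s0"
    using As.idempotent_sandwich[of 0 "alg_poly sA (tau \<theta> d) A"] by (simp add: act_scale_left s0)
  also have "\<dots> = sV (?w * (B \<xi>d \<xi>s0 / B \<xi>d \<xi>d) * (B \<xi>d \<xi>s0 / B \<xi>s0 \<xi>s0)) \<xi>s0"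
    by (simp add: tau_d act_mult act_scale_left act_scale_right s0 E_d Es_0 mult_ac)
  finally have t: "?t = ?w * (B \<xi>d \<xi>s0 / B \<xi>d \<xi>d) * (B \<xi>d \<xi>s0 / B \<xi>s0 \<xi>s0)"
    using s0(2) by simp
  have "sV (node_weight i) (act (Es 0) (act (E i) \<xi>sd))
      = act (sA (node_weight i) (Es 0 * E i * Es d)) \<xi>sd"
    by (simp add: act_scale_left act_mult sd)
  also have "\<dots> = act (sA (node_weight d) (Es 0 * E d * Es d)) \<xi>sd"
    using end_to_end_idempotent[OF i le0 order_refl]
      end_to_end_idempotent[OF order_refl le0 order_refl] by simp
  also have "\<dots> = sV (?w * (B \<xi>d \<xi>sd / B \<xi>d \<xi>d) * (B \<xi>d \<xi>s0 / B \<xi>s0 \<xi>s0)) \<xi>s0"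
    by (simp add: eta_def act_mult act_scale_left act_scale_right sd E_d Es_0 mult_ac)
  finally have step: "sV (node_weight i) (act (Es 0) (act (E i) \<xi>sd))
      = sV (?w * (B \<xi>d \<xi>sd / B \<xi>d \<xi>d) * (B \<xi>d \<xi>s0 / B \<xi>s0 \<xi>s0)) \<xi>s0" .
  let ?K = "poly (eta d \<theta>s d) (\<theta>s 0) / (\<Prod>j=1..d. \<phi> j) * (B \<xi>d \<xi>s0 / B \<xi>d \<xi>sd)"
  have nz: "B \<xi>d \<xi>sd \<noteq> 0"
    using form_end_nonzero[of d] d sd by simp
  have prod: "(\<Prod>j=1..d. \<phi> j) = poly (eta d \<theta>s d) (\<theta>s 0) * ?t"
    by (rule prod_first_split) (rule split)
  have "?K * (?w * (B \<xi>d \<xi>sd / B \<xi>d \<xi>d) * (B \<xi>d \<xi>s0 / B \<xi>s0 \<xi>s0))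
      = 1 / ?t * (?w * (B \<xi>d \<xi>s0 / B \<xi>d \<xi>d) * (B \<xi>d \<xi>s0 / B \<xi>s0 \<xi>s0))"
    unfolding prod using poly_eta_dual_nonzero nz by simp
  also have "\<dots> = 1"
    unfolding t[symmetric] using t_nz by simp
  finally have K: "?K * (?w * (B \<xi>d \<xi>sd / B \<xi>d \<xi>d) * (B \<xi>d \<xi>s0 / B \<xi>s0 \<xi>s0)) = 1" .
  have "act (sA ?K (\<Sum>r\<le>d. sA (node_weight r) (Y r * Es 0 * E r))) (act (E i) \<xi>sd)
      = sV ?K (act (Y i) (sV (node_weight i) (act (Es 0) (act (E i) \<xi>sd))))"
    using i by (simp add: act_scale_left act_scaled_sum[where Y = "\<lambda>r. Y r * Es 0"] act_mult
        act_scale_right)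
  also have "\<dots> = act (Y i) \<xi>s0"
    unfolding step act_scale_right V.scale_scale K by simp
  finally show ?thesis .
qed

end

section \<open>The transition maps\<close>

theorem theorem11p1:
  fixes d :: nat
    and sA :: "'k::field \<Rightarrow> 'a::ring_1 \<Rightarrow> 'a"
    and \<iota> :: "'a \<Rightarrow> 'k mat"
    and sV :: "'k \<Rightarrow> 'v::ab_group_add \<Rightarrow> 'v"
    and act :: "'a \<Rightarrow> 'v \<Rightarrow> 'v"  (infixr "\<diamondop>" 72)
    and A As :: 'a
    and E Es :: "nat \<Rightarrow> 'a"
    and \<theta> \<theta>s \<phi>\<^sub>1 \<phi>\<^sub>2 :: "nat \<Rightarrow> 'k"
    and dag :: "'a \<Rightarrow> 'a"
    and B :: "'v \<Rightarrow> 'v \<Rightarrow> 'k"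
    and \<xi>0 \<xi>d \<xi>s0 \<xi>sd :: 'v
  assumes "full_matrix_algebra d sA \<iota>"
    and "irreducible_left_module sA sV act"
    and "leonard_system d sA \<iota> A E As Es"
    and "parameter_array d sA \<iota> A E As Es \<theta> \<theta>s \<phi>\<^sub>1 \<phi>\<^sub>2"
    and "antiautomorphism sA dag" and "dag A = A" and "dag As = As"
    and "bilinear_form sV B" and "\<exists>u v. B u v \<noteq> 0"
    and "\<And>X u v. B (X \<diamondop> u) v = B u (dag X \<diamondop> v)"
    and "\<xi>0 \<in> range (act (E 0))" and "\<xi>0 \<noteq> 0"
    and "\<xi>d \<in> range (act (E d))" and "\<xi>d \<noteq> 0"
    and "\<xi>s0 \<in> range (act (Es 0))" and "\<xi>s0 \<noteq> 0"
    and "\<xi>sd \<in> range (act (Es d))" and "\<xi>sd \<noteq> 0"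
  shows
    "(\<forall>X \<in> {E, \<lambda>i. E (d - i),
            \<lambda>i. alg_poly sA (tau \<theta> i) A, \<lambda>i. alg_poly sA (tau \<theta> (d - i)) A,
            \<lambda>i. alg_poly sA (eta d \<theta> i) A, \<lambda>i. alg_poly sA (eta d \<theta> (d - i)) A}.
       \<forall>i\<le>d.
        sA (poly (eta d \<theta>s d) (\<theta>s 0) / (\<Prod>j=1..d. \<phi>\<^sub>1 j) * (B \<xi>d \<xi>s0 / B \<xi>d \<xi>sd))
          (\<Sum>r\<le>d. sA (poly (tau \<theta> r) (\<theta> r) * poly (eta d \<theta> (d - r)) (\<theta> r)) (X r * Es 0 * E r))
            \<diamondop> E i \<diamondop> \<xi>sd = X i \<diamondop> \<xi>s0
      \<and> (\<Sum>r\<le>d. sA (1 / tr \<iota> (E r * Es d)) (X r * Es d * E r)) \<diamondop> E i \<diamondop> \<xi>sd = X i \<diamondop> \<xi>sd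
      \<and> sA (poly (eta d \<theta>s d) (\<theta>s 0) / (\<Prod>j=1..d. \<phi>\<^sub>1 j) * (B \<xi>d \<xi>s0 / B \<xi>d \<xi>sd))
          (\<Sum>r\<le>d. sA (poly (tau \<theta> r) (\<theta> r) * poly (eta d \<theta> (d - r)) (\<theta> r)) (X (d - r) * Es 0 * E r))
            \<diamondop> E (d - i) \<diamondop> \<xi>sd = X i \<diamondop> \<xi>s0
      \<and> (\<Sum>r\<le>d. sA (1 / tr \<iota> (E r * Es d)) (X (d - r) * Es d * E r)) \<diamondop> E (d - i) \<diamondop> \<xi>sd = X i \<diamondop> \<xi>sd)
   \<and> (\<forall>X \<in> {Es, \<lambda>i. Es (d - i),
            \<lambda>i. alg_poly sA (tau \<theta>s i) As, \<lambda>i. alg_poly sA (tau \<theta>s (d - i)) As,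
            \<lambda>i. alg_poly sA (eta d \<theta>s i) As, \<lambda>i. alg_poly sA (eta d \<theta>s (d - i)) As}.
       \<forall>i\<le>d.
        sA (B \<xi>0 \<xi>0 / B \<xi>0 \<xi>sd)
          (\<Sum>r\<le>d. sA (1 / tr \<iota> (E r * Es d)) (X r * E 0 * Es d * E r)) \<diamondop> E i \<diamondop> \<xi>sd = X i \<diamondop> \<xi>0
      \<and> sA (B \<xi>d \<xi>d / B \<xi>d \<xi>sd)
          (\<Sum>r\<le>d. sA (1 / tr \<iota> (E r * Es d)) (X r * E d * Es d * E r)) \<diamondop> E i \<diamondop> \<xi>sd = X i \<diamondop> \<xi>d
      \<and> sA (B \<xi>0 \<xi>0 / B \<xi>0 \<xi>sd)
          (\<Sum>r\<le>d. sA (1 / tr \<iota> (E r * Es d)) (X (d - r) * E 0 * Es d * E r))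
            \<diamondop> E (d - i) \<diamondop> \<xi>sd = X i \<diamondop> \<xi>0
      \<and> sA (B \<xi>d \<xi>d / B \<xi>d \<xi>sd)
          (\<Sum>r\<le>d. sA (1 / tr \<iota> (E r * Es d)) (X (d - r) * E d * Es d * E r))
            \<diamondop> E (d - i) \<diamondop> \<xi>sd = X i \<diamondop> \<xi>d)"
proof -
  interpret M: leonard_module d sA \<iota> A E \<theta> As Es \<theta>s sV act dag B
  proof (intro leonard_module.intro leonard_eigenvalues.intro multiplicity_free_element.intro
      multiplicity_free_element_axioms.intro leonard_eigenvalues_axioms.intro
      leonard_module_axioms.intro)
    show "associated_eigenvalues d sA \<iota> A E \<theta>" "associated_eigenvalues d sA \<iota> As Es \<theta>s"
      using assms(4) by (auto simp: parameter_array_def)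
    show "irreducible_tridiagonal d E As" "irreducible_tridiagonal d Es A"
      using assms(3) by (auto simp: leonard_system_def irreducible_tridiagonal_def)
  qed (fact assms)+
  have fixed_E: "E i \<diamondop> v = v" if "v \<in> range (act (E i))" "i \<le> d" for i v
    using that by (auto simp: M.act_mult[symmetric] M.A.idempotent_mult)
  have fixed_Es: "Es i \<diamondop> v = v" if "v \<in> range (act (Es i))" "i \<le> d" for i v
    using that by (auto simp: M.act_mult[symmetric] M.As.idempotent_mult)
  have split: "\<phi>\<^sub>1 i = (\<theta>s 0 - \<theta>s i) *
      (tr \<iota> (alg_poly sA (tau \<theta> i) A * Es 0) / tr \<iota> (alg_poly sA (tau \<theta> (i - 1)) A * Es 0))"
    if "i \<in> {1..d}" for i
    using assms(4) that unfolding parameter_array_def by blast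
  note xi0 = fixed_E[OF assms(11) le0] assms(12)
  note xid = fixed_E[OF assms(13) order_refl] assms(14)
  note xis0 = fixed_Es[OF assms(15) le0] assms(16)
  note xisd = fixed_Es[OF assms(17) order_refl] assms(18)
  note dual_0 = M.transition_dual_0[where \<phi> = \<phi>\<^sub>1, OF split _ xid xis0 xisd]
  note dual_d = M.transition_dual_d[OF _ xisd(1)]
  note primal_0 = M.transition_primal[OF _ le0 xisd xi0]
  note primal_d = M.transition_primal[OF _ order_refl xisd xid]
  show ?thesis
  proof (intro conjI ballI allI impI)
    fix X :: "nat \<Rightarrow> 'a" and i
    assume i: "i \<le> d"
    then have rev: "d - i \<le> d" "d - (d - i) = i"
      by simp_all
    show "sA (poly (eta d \<theta>s d) (\<theta>s 0) / (\<Prod>j=1..d. \<phi>\<^sub>1 j) * (B \<xi>d \<xi>s0 / B \<xi>d \<xi>sd))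
        (\<Sum>r\<le>d. sA (poly (tau \<theta> r) (\<theta> r) * poly (eta d \<theta> (d - r)) (\<theta> r)) (X r * Es 0 * E r))
          \<diamondop> E i \<diamondop> \<xi>sd = X i \<diamondop> \<xi>s0"
      by (rule dual_0[OF _ i])
    show "sA (poly (eta d \<theta>s d) (\<theta>s 0) / (\<Prod>j=1..d. \<phi>\<^sub>1 j) * (B \<xi>d \<xi>s0 / B \<xi>d \<xi>sd))
        (\<Sum>r\<le>d. sA (poly (tau \<theta> r) (\<theta> r) * poly (eta d \<theta> (d - r)) (\<theta> r)) (X (d - r) * Es 0 * E r))
          \<diamondop> E (d - i) \<diamondop> \<xi>sd = X i \<diamondop> \<xi>s0"
      using dual_0[OF _ rev(1), of "\<lambda>r. X (d - r)"] unfolding rev(2) by blast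
    show "(\<Sum>r\<le>d. sA (1 / tr \<iota> (E r * Es d)) (X r * Es d * E r)) \<diamondop> E i \<diamondop> \<xi>sd = X i \<diamondop> \<xi>sd"
      by (rule dual_d[OF i])
    show "(\<Sum>r\<le>d. sA (1 / tr \<iota> (E r * Es d)) (X (d - r) * Es d * E r)) \<diamondop> E (d - i) \<diamondop> \<xi>sd
        = X i \<diamondop> \<xi>sd"
      using dual_d[OF rev(1), of "\<lambda>r. X (d - r)"] unfolding rev(2) .
    show "sA (B \<xi>0 \<xi>0 / B \<xi>0 \<xi>sd)
        (\<Sum>r\<le>d. sA (1 / tr \<iota> (E r * Es d)) (X r * E 0 * Es d * E r)) \<diamondop> E i \<diamondop> \<xi>sd = X i \<diamondop> \<xi>0"
      by (rule primal_0[OF i])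
    show "sA (B \<xi>d \<xi>d / B \<xi>d \<xi>sd)
        (\<Sum>r\<le>d. sA (1 / tr \<iota> (E r * Es d)) (X r * E d * Es d * E r)) \<diamondop> E i \<diamondop> \<xi>sd = X i \<diamondop> \<xi>d"
      by (rule primal_d[OF i])
    show "sA (B \<xi>0 \<xi>0 / B \<xi>0 \<xi>sd)
        (\<Sum>r\<le>d. sA (1 / tr \<iota> (E r * Es d)) (X (d - r) * E 0 * Es d * E r))
          \<diamondop> E (d - i) \<diamondop> \<xi>sd = X i \<diamondop> \<xi>0"
      using primal_0[OF rev(1), of "\<lambda>r. X (d - r)"] unfolding rev(2) .
    show "sA (B \<xi>d \<xi>d / B \<xi>d \<xi>sd)
        (\<Sum>r\<le>d. sA (1 / tr \<iota> (E r * Es d)) (X (d - r) * E d * Es d * E r))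
          \<diamondop> E (d - i) \<diamondop> \<xi>sd = X i \<diamondop> \<xi>d"
      using primal_d[OF rev(1), of "\<lambda>r. X (d - r)"] unfolding rev(2) .
  qed
qed

end
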